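(* Let $\mathcal{P}=(\mathcal{E},D,c,f_c)$ be a combinatorial sum problem, let $E\subseteq\mathcal{E}$ with $|E|=k\ge1$, and let $s\in\{1,\dots,k\}$. Then $l'_{\mathcal{P}}(E)\le\frac{1}{\binom{k-1}{s-1}}\sum_{F\subseteq E,\,|F|=s}l'_{\mathcal{P}}(F)$.
   Context: A combinatorial sum problem (CSP) is a tuple $\mathcal{P}=(\mathcal{E},D,c,f_c)$, where $\mathcal{E}$ is a finite ground set, $D\subseteq 2^{\mathcal{E}}\setminus\{\emptyset\}$ is the set of feasible solutions, $c:\mathcal{E}\to\mathbb{R}$ and $f_c(S)=\sum_{e\in S}c(e)$ for $S\in D$; $c^\ast=\min_{S\in D}f_c(S)$. For $F=\{f_1,\dots,f_m\}\subseteq\mathcal{E}$ and $\vec\alpha\in\mathbb{R}^m$, $\mathcal{P}_{c_{-\vec\alpha,F}}$ is the CSP with cost of $f_i$ changed to $c(f_i)-\alpha_i$ and other costs unchanged; the set lower tolerance is $l'_{\mathcal{P}}(F)=\max\{\alpha\in\mathbb{R}:$ there exists $\vec\alpha$ with all $\alpha_i\ge0$, $\alpha=\sum_i\alpha_i$, such that the optimal value of $\mathcal{P}_{c_{-\vec\alpha,F}}$ equals $c^\ast\}$, with value $\infty$ if this set is unbounded. *)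

theory Defs
  imports Complex_Main "HOL-Library.Extended_Real"
begin

record 'e csp =
  ground :: "'e set"
  feasible :: "'e set set"
  cost :: "'e \<Rightarrow> real"

text \<open>The objective function is determined by the cost function, so it is not a
  separate component. There has to be a feasible solution for the optimal value,
  a minimum, to exist. Values of the cost function outside the ground set are irrelevant.\<close>

definition is_csp :: "'e csp \<Rightarrow> bool" where
  "is_csp P \<longleftrightarrow>
     finite (ground P) \<and> feasible P \<subseteq> Pow (ground P) - {{}} \<and> feasible P \<noteq> {}"

definition objective :: "'e csp \<Rightarrow> 'e set \<Rightarrow> real" where
  "objective P S = (\<Sum>e\<in>S. cost P e)"

definition optimal_value :: "'e csp \<Rightarrow> real" where
  "optimal_value P = Min (objective P ` feasible P)"

text \<open>A vector indexed by the elements of \<open>F\<close> is a function \<open>a\<close> on elements,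
  of which only the values on \<open>F\<close> are used.\<close>

definition decrease_cost :: "'e csp \<Rightarrow> ('e \<Rightarrow> real) \<Rightarrow> 'e set \<Rightarrow> 'e csp" where
  "decrease_cost P a F = P\<lparr>cost := (\<lambda>e. if e \<in> F then cost P e - a e else cost P e)\<rparr>"

definition lower_tolerance_values :: "'e csp \<Rightarrow> 'e set \<Rightarrow> real set" where
  "lower_tolerance_values P F =
     {t. \<exists>a. (\<forall>f\<in>F. a f \<ge> 0) \<and> t = (\<Sum>f\<in>F. a f) \<and>
             optimal_value (decrease_cost P a F) = optimal_value P}"

text \<open>The set of values is closed and contains 0, so it has a greatest element
  whenever it is bounded above.\<close>

definition set_lower_tolerance :: "'e csp \<Rightarrow> 'e set \<Rightarrow> ereal" where
  "set_lower_tolerance P F =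
     (if bdd_above (lower_tolerance_values P F)
      then ereal (GREATEST t. t \<in> lower_tolerance_values P F)
      else \<infinity>)"

end

theory Submission
  imports Defs "HOL-Analysis.Function_Topology"
begin

text \<open>Restricting a cost decrease that preserves the optimal value from \<open>E\<close> to a subset \<open>F\<close>
  still preserves it, because the costs then lie between the decreased and the original ones.
  So an admissible \<open>a\<close> on \<open>E\<close> satisfies \<open>sum a F \<le> l'(F)\<close> for each \<open>F \<subseteq> E\<close>, and in
  the sum over all \<open>F\<close> of size \<open>s\<close> each element of \<open>E\<close> is counted \<open>(k-1) choose (s-1)\<close>
  times. That the tolerance bounds all its values, i.e. that the maximum exists in the bounded
  case, is compactness of the set of admissible vectors in a cube.\<close>

lemma is_csp_finite:
  assumes "is_csp P"
  shows "finite (feasible P)" "feasible P \<noteq> {}"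
  using assms by (auto simp: is_csp_def intro: finite_subset[of _ "Pow (ground P)"])

lemma feasible_decrease_cost [simp]: "feasible (decrease_cost P a F) = feasible P"
  by (simp add: decrease_cost_def)

lemma cost_decrease_cost:
  "cost (decrease_cost P a F) e = (if e \<in> F then cost P e - a e else cost P e)"
  by (simp add: decrease_cost_def)

lemma decrease_cost_empty [simp]: "decrease_cost P a {} = P"
  by (simp add: decrease_cost_def)

lemma optimal_value_eq_iff:
  assumes "is_csp P"
  shows "optimal_value P = v \<longleftrightarrow>
    (\<forall>S\<in>feasible P. v \<le> objective P S) \<and> (\<exists>S\<in>feasible P. objective P S = v)"
  using is_csp_finite[OF assms]
  by (auto simp: optimal_value_def Min_eq_iff)

lemma is_csp_decrease_cost [simp]: "is_csp (decrease_cost P a F) = is_csp P"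
  by (simp add: is_csp_def decrease_cost_def)

text \<open>A solution optimal under the decrease on \<open>F\<close> stays feasible and can only
  become cheaper when the decrease is extended to \<open>E\<close>.\<close>

lemma optimal_value_decrease_cost_antimono:
  assumes P: "is_csp P" and "F \<subseteq> E" and "\<forall>e\<in>E. 0 \<le> a e"
  shows "optimal_value (decrease_cost P a E) \<le> optimal_value (decrease_cost P a F)"
proof -
  obtain S where S: "S \<in> feasible P"
      "objective (decrease_cost P a F) S = optimal_value (decrease_cost P a F)"
    using optimal_value_eq_iff[of "decrease_cost P a F"] P by auto
  have "optimal_value (decrease_cost P a E) \<le> objective (decrease_cost P a E) S"
    using optimal_value_eq_iff[of "decrease_cost P a E"] P S(1) by auto
  also have "\<dots> \<le> objective (decrease_cost P a F) S"
    unfolding objective_def by (rule sum_mono) (use assms in \<open>auto simp: cost_decrease_cost\<close>)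
  finally show ?thesis using S(2) by simp
qed

lemma lower_tolerance_values_subset:
  assumes P: "is_csp P" and "F \<subseteq> E" and a: "\<forall>e\<in>E. 0 \<le> a e"
    and opt: "optimal_value (decrease_cost P a E) = optimal_value P"
  shows "sum a F \<in> lower_tolerance_values P F"
proof -
  have "optimal_value (decrease_cost P a F) = optimal_value P"
    \<comment> \<open>The optimum for \<open>F\<close> is squeezed: \<open>F \<subseteq> E\<close>
      bounds it below, and \<open>{} \<subseteq> F\<close> bounds it above, the empty decrease being
      \<open>P\<close> itself.\<close>
    using optimal_value_decrease_cost_antimono[OF P \<open>F \<subseteq> E\<close> a]
      optimal_value_decrease_cost_antimono[OF P, of "{}" F a] assms
    by (simp add: subset_iff)
  then show ?thesis
    using assms by (auto simp: lower_tolerance_values_def)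
qed

lemma zero_in_lower_tolerance_values: "0 \<in> lower_tolerance_values P F"
  by (auto simp: lower_tolerance_values_def decrease_cost_def cong: if_cong intro!: exI[of _ "\<lambda>_. 0"])

lemma continuous_on_objective_decrease_cost:
  "continuous_on UNIV (\<lambda>a. objective (decrease_cost P a F) S)"
  unfolding objective_def cost_decrease_cost
proof (rule continuous_on_sum)
  fix e
  show "continuous_on UNIV (\<lambda>a. if e \<in> F then cost P e - a e else cost P e)"
    by (cases "e \<in> F") (simp_all add: continuous_on_diff continuous_on_product_coordinates)
qed

text \<open>Each objective value is continuous in \<open>a\<close>, and being the minimum is an
  intersection of closed conditions with a union of closed ones; the union stays closed because
  there are finitely many feasible solutions.\<close>

lemma closed_optimal_value_decrease_cost:
  assumes P: "is_csp P"
  shows "closed {a. optimal_value (decrease_cost P a F) = v}"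
proof -
  have "{a. optimal_value (decrease_cost P a F) = v} =
      (\<Inter>S\<in>feasible P. {a. v \<le> objective (decrease_cost P a F) S}) \<inter>
      (\<Union>S\<in>feasible P. {a. objective (decrease_cost P a F) S = v})"
    using P by (auto simp: optimal_value_eq_iff)
  also have "closed \<dots>"
    using is_csp_finite(1)[OF P]
    by (intro closed_Int closed_INT closed_UN ballI closed_Collect_le closed_Collect_eq
        continuous_on_objective_decrease_cost continuous_on_const)
  finally show ?thesis .
qed

lemma lower_tolerance_values_has_max:
  assumes P: "is_csp P" and "finite F" and "bdd_above (lower_tolerance_values P F)"
  obtains m where "m \<in> lower_tolerance_values P F"
    and "\<And>t. t \<in> lower_tolerance_values P F \<Longrightarrow> t \<le> m"
proof -
  obtain B where B: "\<And>t. t \<in> lower_tolerance_values P F \<Longrightarrow> t \<le> B"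
    using assms by (auto simp: bdd_above_def)
  \<comment> \<open>Coordinates outside \<open>F\<close> are irrelevant, so they are pinned at 0.
    All factors are then compact and \<open>K\<close> is compact by Tychonoff, even if the element
    type is infinite.\<close>
  define K where "K = PiE UNIV (\<lambda>e. if e \<in> F then {0..B} else {0})"
  define A where "A = K \<inter> {a. optimal_value (decrease_cost P a F) = optimal_value P}"
  have "compactin (product_topology (\<lambda>i. euclidean) UNIV) K"
    unfolding K_def by (auto simp: compactin_PiE)
  then have "compact A"
    unfolding A_def
    by (intro compact_Int_closed closed_optimal_value_decrease_cost P)
       (simp add: euclidean_product_topology)
  then have cpt: "compact ((\<lambda>a. sum a F) ` A)"
    by (intro compact_continuous_image continuous_on_sum
        continuous_on_subset[OF continuous_on_product_coordinates] subset_UNIV)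
  have values_eq: "lower_tolerance_values P F = (\<lambda>a. sum a F) ` A"
  proof (intro set_eqI iffI)
    fix t assume t: "t \<in> lower_tolerance_values P F"
    then obtain a where a: "\<forall>f\<in>F. 0 \<le> a f" "t = sum a F"
        "optimal_value (decrease_cost P a F) = optimal_value P"
      by (auto simp: lower_tolerance_values_def)
    \<comment> \<open>\<open>a\<close> is arbitrary outside \<open>F\<close>; truncating it there
      puts it in \<open>K\<close> without changing the costs or the sum.\<close>
    define b where "b = (\<lambda>e. if e \<in> F then a e else 0)"
    have "decrease_cost P b F = decrease_cost P a F"
      unfolding decrease_cost_def b_def
      by (rule arg_cong[where f = "\<lambda>c. P\<lparr>cost := c\<rparr>"]) auto
    \<comment> \<open>A single coordinate is at most the sum of the nonnegative coordinates, which
      is the tolerance value \<open>t\<close>.\<close>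
    moreover have "a f \<le> B" if "f \<in> F" for f
      using member_le_sum[OF that, of a] a B[OF t] \<open>finite F\<close> by auto
    ultimately have "b \<in> A"
      using a by (auto simp: A_def K_def b_def)
    moreover have "t = sum b F"
      using a(2) by (simp add: b_def)
    ultimately show "t \<in> (\<lambda>a. sum a F) ` A" by auto
  next
    fix t assume "t \<in> (\<lambda>a. sum a F) ` A"
    then obtain a where a: "a \<in> A" "t = sum a F" by auto
    have "a \<in> K"
      using a(1) by (simp add: A_def)
    have "0 \<le> a f" if "f \<in> F" for f
      using PiE_mem[OF \<open>a \<in> K\<close>[unfolded K_def], of f] that by simp
    with a show "t \<in> lower_tolerance_values P F"
      by (auto simp: lower_tolerance_values_def A_def)
  qed
  have "lower_tolerance_values P F \<noteq> {}"
    using zero_in_lower_tolerance_values by blast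
  then show ?thesis
    using compact_attains_sup[OF cpt[folded values_eq]] that by blast
qed

text \<open>As a supremum in \<open>ereal\<close>, the tolerance needs no further case split between
  bounded and unbounded values.\<close>

lemma set_lower_tolerance_eq_SUP:
  assumes "is_csp P" and "finite F"
  shows "set_lower_tolerance P F = (SUP t\<in>lower_tolerance_values P F. ereal t)"
proof (cases "bdd_above (lower_tolerance_values P F)")
  case True
  obtain m where m: "m \<in> lower_tolerance_values P F"
      "\<And>t. t \<in> lower_tolerance_values P F \<Longrightarrow> t \<le> m"
    using lower_tolerance_values_has_max[OF assms True] by blast
  then have "(GREATEST t. t \<in> lower_tolerance_values P F) = m"
    by (intro Greatest_equality) auto
  moreover have "(SUP t\<in>lower_tolerance_values P F. ereal t) = ereal m"
    using m by (intro antisym SUP_least SUP_upper) auto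
  ultimately show ?thesis
    using True by (simp add: set_lower_tolerance_def)
next
  case False
  have "(SUP t\<in>lower_tolerance_values P F. ereal t) = \<infinity>"
  proof (rule SUP_PInfty)
    fix n :: nat
    show "\<exists>t\<in>lower_tolerance_values P F. ereal (real n) \<le> ereal t"
      using False by (auto simp: bdd_above_def not_le intro: less_imp_le)
  qed
  then show ?thesis
    using False by (simp add: set_lower_tolerance_def)
qed

text \<open>Removing \<open>x\<close> is a bijection onto the subsets of \<open>E - {x}\<close> of
  size \<open>s - 1\<close>; \<open>s \<ge> 1\<close> keeps this subtraction from
  truncating.\<close>

lemma card_subsets_containing:
  assumes "finite E" and "x \<in> E" and "s \<ge> 1"
  shows "card {F. F \<subseteq> E \<and> card F = s \<and> x \<in> F} = (card E - 1) choose (s - 1)"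
proof -
  have "bij_betw (insert x) {G. G \<subseteq> E - {x} \<and> card G = s - 1}
      {F. F \<subseteq> E \<and> card F = s \<and> x \<in> F}"
  proof (rule bij_betw_byWitness[where f' = "\<lambda>F. F - {x}"])
    show "insert x ` {G. G \<subseteq> E - {x} \<and> card G = s - 1}
        \<subseteq> {F. F \<subseteq> E \<and> card F = s \<and> x \<in> F}"
    proof clarify
      fix G assume "G \<subseteq> E - {x}" "card G = s - 1"
      moreover from this have "finite G" "x \<notin> G"
        using assms(1) by (auto intro: finite_subset)
      ultimately show "insert x G \<subseteq> E \<and> card (insert x G) = s \<and> x \<in> insert x G"
        using assms by auto
    qed
  qed auto
  then have "card {F. F \<subseteq> E \<and> card F = s \<and> x \<in> F}
      = card {G. G \<subseteq> E - {x} \<and> card G = s - 1}"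
    by (rule bij_betw_same_card[symmetric])
  also have "\<dots> = card (E - {x}) choose (s - 1)"
    using assms(1) by (intro n_subsets) auto
  finally show ?thesis
    using assms by simp
qed

lemma sum_over_subsets:
  fixes a :: "'a \<Rightarrow> 'b::comm_semiring_1"
  assumes "finite E" and "s \<ge> 1"
  shows "(\<Sum>F | F \<subseteq> E \<and> card F = s. sum a F)
    = of_nat ((card E - 1) choose (s - 1)) * sum a E"
proof -
  let ?\<F> = "{F. F \<subseteq> E \<and> card F = s}"
  have "(\<Sum>F\<in>?\<F>. sum a F) = (\<Sum>F\<in>?\<F>. \<Sum>x | x \<in> E \<and> x \<in> F. a x)"
    by (intro sum.cong) auto
  \<comment> \<open>Double counting: exchange the sums over sets and over their elements.\<close>
  also have "\<dots> = (\<Sum>x\<in>E. \<Sum>F | F \<in> ?\<F> \<and> x \<in> F. a x)"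
    using assms(1) by (intro sum.swap_restrict) auto
  also have "\<dots> = (\<Sum>x\<in>E. of_nat ((card E - 1) choose (s - 1)) * a x)"
    using card_subsets_containing[OF assms(1) _ assms(2)] by (simp add: conj_assoc)
  finally show ?thesis
    by (simp add: sum_distrib_left)
qed

theorem theorem14:
  fixes P :: "'e csp" and E :: "'e set" and k s :: nat
  assumes "is_csp P"
    and "E \<subseteq> ground P"
    and "card E = k"
    and "k \<ge> 1"
    and "s \<in> {1..k}"
  shows "set_lower_tolerance P E
    \<le> ereal (1 / real ((k - 1) choose (s - 1)))
        * (\<Sum>F\<in>{F. F \<subseteq> E \<and> card F = s}. set_lower_tolerance P F)"
proof -
  let ?\<F> = "{F. F \<subseteq> E \<and> card F = s}"
  define N where "N = real ((k - 1) choose (s - 1))"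
  have "finite E"
    using assms(3,4) by (auto intro: card_ge_0_finite)
  \<comment> \<open>The binomial coefficient is nonzero since
    \<open>s - 1 \<le> k - 1\<close>.\<close>
  have "N > 0"
    using assms(5) by (auto simp: N_def)
  \<comment> \<open>The left-hand side is a supremum, so it suffices to bound each value
    \<open>t\<close>; the right-hand side may be infinite.\<close>
  have "ereal t \<le> ereal (1 / N) * (\<Sum>F\<in>?\<F>. set_lower_tolerance P F)"
    if "t \<in> lower_tolerance_values P E" for t
  proof -
    from that obtain a where a: "\<forall>e\<in>E. 0 \<le> a e" "t = sum a E"
        "optimal_value (decrease_cost P a E) = optimal_value P"
      by (auto simp: lower_tolerance_values_def)
    have "ereal t = ereal (1 / N) * ereal (\<Sum>F\<in>?\<F>. sum a F)"
      using sum_over_subsets[of E s a] \<open>finite E\<close> \<open>N > 0\<close> assms(3,5) a(2) by (simp add: N_def)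
    also have "\<dots> = ereal (1 / N) * (\<Sum>F\<in>?\<F>. ereal (sum a F))"
      by simp
    also have "\<dots> \<le> ereal (1 / N) * (\<Sum>F\<in>?\<F>. set_lower_tolerance P F)"
    proof (intro ereal_mult_left_mono sum_mono)
      fix F assume F: "F \<in> ?\<F>"
      then have "finite F"
        using \<open>finite E\<close> by (auto intro: finite_subset)
      moreover have "sum a F \<in> lower_tolerance_values P F"
        using lower_tolerance_values_subset[OF assms(1) _ a(1,3)] F by auto
      ultimately show "ereal (sum a F) \<le> set_lower_tolerance P F"
        using set_lower_tolerance_eq_SUP[OF assms(1)] by (auto intro: SUP_upper)
    qed (use \<open>N > 0\<close> in auto)
    finally show ?thesis .
  qed
  then show ?thesis
    unfolding set_lower_tolerance_eq_SUP[OF assms(1) \<open>finite E\<close>] N_def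
    by (intro SUP_least)
qed

end
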